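(* For $p\in[1,+\infty]$, let $l_p^3=(\mathbb{R}^3,\|\cdot\|_p)$. Then $$\beta(l_p^3,8)\leq\begin{cases}\dfrac{\sqrt{18\cdot 19}}{20}, & p\in[1,2),\\[2mm] \dfrac{3^{1/p}}{2}, & p\in[2,+\infty],\end{cases}$$ where $3^{1/p}=1$ for $p=+\infty$.
   Context: All spaces are real. For $X=(\mathbb{R}^n,\|\cdot\|)$ and a nonempty bounded set $A\subset\mathbb{R}^n$, $\delta(A)=\sup\{\|x-y\| : x,y\in A\}$ is the diameter of $A$ in $X$. Let $\mathcal{B}^n$ be the family of all bounded subsets of $\mathbb{R}^n$ with positive diameter. For a positive integer $m$ and $A\in\mathcal{B}^n$, $$\beta_X(A,m)=\inf\left\{\frac{1}{\delta(A)}\max_{1\leq k\leq m}\delta(A_k) : A=\bigcup_{k=1}^m A_k\right\},$$ where the empty set, if it occurs among the $A_k$, is given diameter $0$. Put $\beta(X,m)=\sup\{\beta_X(A,m) : A\in\mathcal{B}^n\}$. Here $\|\cdot\|_p$ is the usual $\ell_p$ norm (the maximum norm for $p=+\infty$). *)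

theory Defs
  imports "HOL-Analysis.Analysis"
begin

text \<open>
  The space \<open>X = (\<real>\<^sup>n, \<parallel>\<cdot>\<parallel>)\<close> is represented by the function \<open>N :: real ^ 'n \<Rightarrow> real\<close> that
  gives its norm.  The library's \<^const>\<open>diameter\<close> refers to the Euclidean norm of the type
  and is therefore not usable here.
\<close>

definition diam :: "(real ^ 'n \<Rightarrow> real) \<Rightarrow> (real ^ 'n) set \<Rightarrow> real" where
  "diam N A = (if A = {} then 0 else Sup {N (x - y) | x y. x \<in> A \<and> y \<in> A})"

text \<open>
  All norms on \<open>\<real>\<^sup>n\<close> are equivalent, so \<^const>\<open>bounded\<close> (Euclidean) is boundedness in \<open>X\<close>.
\<close>

definition bounded_pos_diam :: "(real ^ 'n \<Rightarrow> real) \<Rightarrow> (real ^ 'n) set set" where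
  "bounded_pos_diam N = {A. bounded A \<and> diam N A > 0}"

definition beta_set :: "(real ^ 'n \<Rightarrow> real) \<Rightarrow> (real ^ 'n) set \<Rightarrow> nat \<Rightarrow> real" where
  "beta_set N A m =
     Inf {1 / diam N A * Max ((\<lambda>k. diam N (P k)) ` {1..m}) | P :: nat \<Rightarrow> (real ^ 'n) set.
          A = (\<Union>k\<in>{1..m}. P k)}"

text \<open>
  For a norm \<open>N\<close>, \<open>m \<ge> 1\<close> and \<open>A \<in> bounded_pos_diam N\<close>, the infimum above is over a nonempty set of
  nonnegative reals and is at most \<open>1\<close> (take every \<open>P k = A\<close>); hence the supremum below is
  over a nonempty subset of \<open>[0, 1]\<close>.
\<close>

definition beta :: "(real ^ 'n \<Rightarrow> real) \<Rightarrow> nat \<Rightarrow> real" where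
  "beta N m = Sup {beta_set N A m | A. A \<in> bounded_pos_diam N}"

definition lp_norm :: "ereal \<Rightarrow> real ^ 'n \<Rightarrow> real" where
  "lp_norm p x =
     (if p = \<infinity> then Max (range (\<lambda>i. \<bar>x $ i\<bar>))
      else (\<Sum>i\<in>UNIV. \<bar>x $ i\<bar> powr real_of_ereal p) powr (1 / real_of_ereal p))"

end

theory Submission
  imports Defs
begin

text \<open>
  The idea is to replace the norm by a parallelepiped.  Suppose that functionals \<open>f i\<close>, indexed by a
  type with \<open>k\<close> elements, satisfy \<open>\<bar>f i \<bullet> x\<bar> \<le> c * N x\<close>, and that every \<open>x\<close> with all \<open>\<bar>f i \<bullet> x\<bar> \<le> e\<close> has
  \<open>N x \<le> K * e\<close>.  A set of \<open>N\<close>-diameter \<open>d\<close> then lies in a box that has width \<open>c * d\<close> in each of the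
  functionals.  Halving the box in every direction gives \<open>2 ^ k\<close> cells of \<open>N\<close>-diameter at most
  \<open>c * K * d / 2\<close>, whence \<open>\<beta> \<le> c * K / 2\<close> (lemma \<open>beta_le_parallelepiped\<close>).  In terms of Banach spaces
  with \<open>k\<close> equal to the dimension, \<open>c * K\<close> bounds the Banach--Mazur distance to the space with the
  maximum norm.

  For \<open>p \<ge> 2\<close> the coordinate functionals suffice, with \<open>c = 1\<close> and \<open>K = 3 powr (1 / p)\<close>.  As \<open>p\<close> tends
  to \<open>1\<close> this value of \<open>K\<close> grows to \<open>3\<close>, and \<open>c * K / 2\<close> exceeds the trivial bound \<open>1\<close>.  For \<open>p < 2\<close> the functionals are the three
  permutations of \<open>(-1/3, 1, 1)\<close> instead.  With them both \<open>c\<close> and \<open>K\<close> are easy to compute at the two ends: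
  \<open>c = 1\<close> and \<open>K = 9/5\<close> for \<open>p = 1\<close>, and \<open>c\<^sup>2 = 19/9\<close> and \<open>K\<^sup>2 = 81/50\<close> for \<open>p = 2\<close>.  In between, the
  logarithms of the \<open>\<ell>\<^sub>p\<close> norm of a vector and of its dual norm are convex functions of \<open>1/p\<close>, so the
  product \<open>c * K\<close> is at most the weighted geometric mean of its end values \<open>9/5\<close> and
  \<open>sqrt (19/9 * 81/50) = sqrt (18 * 19) / 10\<close>.  The second of these is the larger, and half of it is
  the bound claimed.  Both convexity statements are instances of Hoelder's inequality
  (\<open>sum_powr_interpolation\<close>, \<open>inner_le_interpolation\<close>).
\<close>

section \<open>Partition into the cells of a parallelepiped\<close>

lemma diam_le:
  assumes "0 \<le> b" and "\<And>x y. x \<in> A \<Longrightarrow> y \<in> A \<Longrightarrow> N (x - y) \<le> b"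
  shows "diam N A \<le> b"
proof (cases "A = {}")
  case False
  then have "{N (x - y) | x y. x \<in> A \<and> y \<in> A} \<noteq> {}"
    by blast
  then have "Sup {N (x - y) | x y. x \<in> A \<and> y \<in> A} \<le> b"
    by (rule cSup_least) (use assms(2) in blast)
  with False show ?thesis
    by (simp add: diam_def)
qed (use assms(1) in \<open>simp add: diam_def\<close>)

lemma le_diam:
  assumes "x \<in> A" "y \<in> A" and "\<And>x y. x \<in> A \<Longrightarrow> y \<in> A \<Longrightarrow> N (x - y) \<le> M"
  shows "N (x - y) \<le> diam N A"
proof -
  have "bdd_above {N (x - y) | x y. x \<in> A \<and> y \<in> A}"
    using assms(3) by (auto intro!: bdd_aboveI[of _ M])
  then show ?thesis
    using assms(1,2) unfolding diam_def by (auto intro!: cSup_upper)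
qed

text \<open>
  The lower bound for \<open>N\<close> confines a set of given diameter to a box, and the upper bound controls the
  diameters of the cells; it also makes the suprema that define \<^const>\<open>diam\<close> finite.  The
  nonzero functional guarantees that some set has positive diameter: otherwise the supremum that
  defines \<^const>\<open>beta\<close> would be taken over the empty set and have no known value.
\<close>

lemma beta_le_parallelepiped:
  fixes N :: "real ^ 'n \<Rightarrow> real" and f :: "'k::finite \<Rightarrow> real ^ 'n"
  assumes c: "0 < c" and nz: "f i0 \<noteq> 0"
    and lower: "\<And>i x. \<bar>f i \<bullet> x\<bar> \<le> c * N x"
    and upper: "\<And>x e. 0 < e \<Longrightarrow> (\<And>i. \<bar>f i \<bullet> x\<bar> \<le> e) \<Longrightarrow> N x \<le> K * e"
  shows "beta N (2 ^ CARD('k)) \<le> c * K / 2"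
proof -
  let ?m = "2 ^ CARD('k) :: nat"
  have N_nonneg: "0 \<le> N x" for x
  proof -
    have "0 \<le> c * N x"
      using lower[of i0 x] by linarith
    with c show ?thesis
      by (simp add: zero_le_mult_iff)
  qed
  have K_nonneg: "0 \<le> K"
    using upper[of 1 0] N_nonneg[of 0] by simp
  have N_bounded: "\<exists>M. \<forall>x\<in>A. \<forall>y\<in>A. N (x - y) \<le> M" if bA: "bounded A" for A
  proof -
    obtain B where B: "0 < B" "\<And>x. x \<in> A \<Longrightarrow> norm x \<le> B"
      using bA by (auto simp: bounded_pos)
    define R where "R = (\<Sum>i\<in>UNIV. norm (f i)) * (2 * B) + 1"
    have R: "0 < R"
      unfolding R_def using B(1) by (intro add_nonneg_pos mult_nonneg_nonneg sum_nonneg) auto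
    have "N (x - y) \<le> K * R" if "x \<in> A" "y \<in> A" for x y
    proof (rule upper[OF R])
      fix i
      have "\<bar>f i \<bullet> (x - y)\<bar> \<le> norm (f i) * norm (x - y)"
        by (rule Cauchy_Schwarz_ineq2)
      also have "\<dots> \<le> (\<Sum>i\<in>UNIV. norm (f i)) * (2 * B)"
      proof (intro mult_mono)
        show "norm (f i) \<le> (\<Sum>i\<in>UNIV. norm (f i))"
          by (rule member_le_sum) auto
        show "norm (x - y) \<le> 2 * B"
          using norm_triangle_ineq4[of x y] B(2)[OF that(1)] B(2)[OF that(2)] by linarith
      qed (auto intro: sum_nonneg)
      also have "\<dots> \<le> R"
        by (simp add: R_def)
      finally show "\<bar>f i \<bullet> (x - y)\<bar> \<le> R" .
    qed
    then show ?thesis by blast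
  qed
  have diam_nonneg: "0 \<le> diam N A" if "bounded A" for A
  proof (cases "A = {}")
    case False
    then obtain x where x: "x \<in> A" by blast
    obtain M where "\<forall>x\<in>A. \<forall>y\<in>A. N (x - y) \<le> M"
      using N_bounded[OF \<open>bounded A\<close>] by blast
    then have "N (x - x) \<le> diam N A"
      using le_diam[OF x x, of N M] by blast
    with N_nonneg[of "x - x"] show ?thesis by linarith
  qed (simp add: diam_def)
  have beta_set_le: "beta_set N A ?m \<le> c * K / 2" if "A \<in> bounded_pos_diam N" for A
  proof -
    have bA: "bounded A" and dpos: "0 < diam N A"
      using that by (auto simp: bounded_pos_diam_def)
    define d where "d = diam N A"
    \<comment> \<open>half the width of the circumscribed box, hence the width of a cell\<close>
    define e where "e = c * d / 2"
    have e: "0 < e"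
      using dpos c by (simp add: e_def d_def)
    obtain M where "\<forall>x\<in>A. \<forall>y\<in>A. N (x - y) \<le> M"
      using N_bounded[OF bA] by blast
    then have N_le: "N (x - y) \<le> d" if "x \<in> A" "y \<in> A" for x y
      unfolding d_def using le_diam[OF that, of N M] by blast
    define l where "l i = Inf ((\<lambda>x. f i \<bullet> x) ` A)" for i
    have width: "f i \<bullet> x - f i \<bullet> y \<le> 2 * e" if "x \<in> A" "y \<in> A" for i x y
    proof -
      have "f i \<bullet> x - f i \<bullet> y \<le> c * N (x - y)"
        using lower[of i "x - y"] by (simp add: inner_diff_right)
      also have "\<dots> \<le> c * d"
        using N_le[OF that] c by simp
      finally show ?thesis by (simp add: e_def)
    qed
    have l_le: "l i \<le> f i \<bullet> x" if "x \<in> A" for i x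
      unfolding l_def
    proof (rule cInf_lower)
      show "bdd_below ((\<lambda>x. f i \<bullet> x) ` A)"
        using width[OF \<open>x \<in> A\<close>] by (intro bdd_belowI[of _ "f i \<bullet> x - 2 * e"]) (auto simp: algebra_simps)
    qed (use that in auto)
    have le_l: "f i \<bullet> x \<le> l i + 2 * e" if "x \<in> A" for i x
    proof -
      have "f i \<bullet> x - 2 * e \<le> l i"
        unfolding l_def using width[OF that] that
        by (intro cInf_greatest) (auto simp: algebra_simps)
      then show ?thesis by simp
    qed
    \<comment> \<open>A cell is indexed by the set of directions in which it takes the lower half of the box.\<close>
    define cell where "cell S = {x \<in> A. \<forall>i. i \<in> S \<longleftrightarrow> f i \<bullet> x \<le> l i + e}" for S
    have diam_cell: "diam N (cell S) \<le> c * K / 2 * d" for S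
    proof (rule diam_le)
      show "0 \<le> c * K / 2 * d"
        using c K_nonneg dpos by (simp add: d_def)
      fix x y assume xy: "x \<in> cell S" "y \<in> cell S"
      have "N (x - y) \<le> K * e"
      proof (rule upper[OF e])
        fix i
        have A: "x \<in> A" "y \<in> A"
          and iff: "i \<in> S \<longleftrightarrow> f i \<bullet> x \<le> l i + e" "i \<in> S \<longleftrightarrow> f i \<bullet> y \<le> l i + e"
          using xy unfolding cell_def by blast+
        show "\<bar>f i \<bullet> (x - y)\<bar> \<le> e"
        proof (cases "i \<in> S")
          case True
          with iff have "f i \<bullet> x \<le> l i + e" "f i \<bullet> y \<le> l i + e"
            by simp_all
          with l_le[OF A(1), of i] l_le[OF A(2), of i] show ?thesis
            by (simp add: inner_diff_right abs_le_iff)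
        next
          case False
          with iff have "l i + e < f i \<bullet> x" "l i + e < f i \<bullet> y"
            by simp_all
          with le_l[OF A(1), of i] le_l[OF A(2), of i] show ?thesis
            by (simp add: inner_diff_right abs_le_iff)
        qed
      qed
      then show "N (x - y) \<le> c * K / 2 * d"
        by (simp add: e_def mult_ac)
    qed
    have "card {1..?m} = card (UNIV :: 'k set set)"
      by (simp add: card_Pow flip: Pow_UNIV)
    then obtain h :: "nat \<Rightarrow> 'k set" where h: "bij_betw h {1..?m} UNIV"
      using finite_same_card_bij[of "{1..?m}" "UNIV :: 'k set set"] by auto
    define P where "P k = cell (h k)" for k
    have cover: "A = (\<Union>k\<in>{1..?m}. P k)"
    proof
      show "A \<subseteq> (\<Union>k\<in>{1..?m}. P k)"
      proof
        fix x assume x: "x \<in> A"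
        have "{i. f i \<bullet> x \<le> l i + e} \<in> h ` {1..?m}"
          unfolding bij_betw_imp_surj_on[OF h] by (rule UNIV_I)
        then obtain k where k: "k \<in> {1..?m}" "h k = {i. f i \<bullet> x \<le> l i + e}"
          by (elim imageE) simp
        then have "x \<in> P k"
          using x by (simp add: P_def cell_def)
        with k(1) show "x \<in> (\<Union>k\<in>{1..?m}. P k)" by blast
      qed
    qed (auto simp: P_def cell_def)
    let ?V = "{1 / diam N A * Max ((\<lambda>k. diam N (P k)) ` {1..?m}) | P :: nat \<Rightarrow> (real ^ 'n) set.
          A = (\<Union>k\<in>{1..?m}. P k)}"
    have "beta_set N A ?m \<le> 1 / diam N A * Max ((\<lambda>k. diam N (P k)) ` {1..?m})"
      unfolding beta_set_def
    proof (rule cInf_lower)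
      show "bdd_below ?V"
      proof (rule bdd_belowI[of _ 0])
        fix v assume "v \<in> ?V"
        then obtain Q where Q: "A = (\<Union>k\<in>{1..?m}. Q k)"
          and v: "v = 1 / diam N A * Max ((\<lambda>k. diam N (Q k)) ` {1..?m})" by blast
        have "bounded (Q 1)"
          using bA by (rule bounded_subset) (use Q in auto)
        then have "0 \<le> diam N (Q 1)"
          by (rule diam_nonneg)
        also have "\<dots> \<le> Max ((\<lambda>k. diam N (Q k)) ` {1..?m})"
          by (rule Max_ge) auto
        finally show "0 \<le> v"
          using dpos by (simp add: v)
      qed
    qed (use cover in blast)
    also have "\<dots> \<le> 1 / diam N A * (c * K / 2 * d)"
      using dpos diam_cell by (intro mult_left_mono Max.boundedI) (auto simp: P_def)
    also have "\<dots> = c * K / 2"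
      using dpos by (simp add: d_def)
    finally show ?thesis .
  qed
  have "0 < N (f i0)"
  proof -
    have "0 < \<bar>f i0 \<bullet> f i0\<bar>"
      using nz by simp
    also have "\<dots> \<le> c * N (f i0)"
      by (rule lower)
    finally show ?thesis
      using c by (simp add: zero_less_mult_iff)
  qed
  moreover have "N (f i0 - 0) \<le> diam N {f i0, 0}"
  proof -
    obtain M where "\<forall>x\<in>{f i0, 0}. \<forall>y\<in>{f i0, 0}. N (x - y) \<le> M"
      using N_bounded[of "{f i0, 0}"] by auto
    then show ?thesis
      by (intro le_diam[of _ _ _ N M]) auto
  qed
  ultimately have "{f i0, 0} \<in> bounded_pos_diam N"
    by (simp add: bounded_pos_diam_def)
  then show ?thesis
    unfolding beta_def using beta_set_le by (intro cSup_least) auto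
qed

section \<open>Large exponents: the coordinate cube\<close>

lemma beta_lp_norm_le:
  fixes p :: ereal
  assumes p: "1 \<le> p" "p \<noteq> \<infinity>"
  shows "beta (lp_norm p :: real ^ 'n \<Rightarrow> real) (2 ^ CARD('n))
           \<le> real CARD('n) powr (1 / real_of_ereal p) / 2"
proof -
  define r where "r = real_of_ereal p"
  have r: "1 \<le> r"
    unfolding r_def using p by (cases p) auto
  have lp: "lp_norm p x = (\<Sum>i\<in>UNIV. \<bar>x $ i\<bar> powr r) powr (1 / r)" for x :: "real ^ 'n"
    using p(2) by (simp add: lp_norm_def r_def)
  have "beta (lp_norm p :: real ^ 'n \<Rightarrow> real) (2 ^ CARD('n))
      \<le> 1 * real CARD('n) powr (1 / r) / 2"
  proof (rule beta_le_parallelepiped[where f = "\<lambda>i. axis i 1"])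
    show "axis (undefined :: 'n) (1::real) \<noteq> 0"
      by (simp add: axis_eq_0_iff)
    fix i :: 'n and x :: "real ^ 'n"
    have "\<bar>x $ i\<bar> = (\<bar>x $ i\<bar> powr r) powr (1 / r)"
      using r by (simp add: powr_powr)
    also have "\<dots> \<le> (\<Sum>i\<in>UNIV. \<bar>x $ i\<bar> powr r) powr (1 / r)"
      using r by (intro powr_mono2 member_le_sum) auto
    finally show "\<bar>axis i 1 \<bullet> x\<bar> \<le> 1 * lp_norm p x"
      by (simp add: lp inner_axis')
  next
    fix x :: "real ^ 'n" and e :: real
    assume e: "0 < e" and box: "\<And>i. \<bar>axis i 1 \<bullet> x\<bar> \<le> e"
    have "(\<Sum>i\<in>UNIV. \<bar>x $ i\<bar> powr r) \<le> (\<Sum>i\<in>(UNIV::'n set). e powr r)"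
      using box r by (intro sum_mono powr_mono2) (auto simp: inner_axis')
    then have "lp_norm p x \<le> (real CARD('n) * e powr r) powr (1 / r)"
      unfolding lp using r by (intro powr_mono2) (auto intro: sum_nonneg)
    also have "\<dots> = real CARD('n) powr (1 / r) * e"
      using r e by (simp add: powr_mult powr_powr)
    finally show "lp_norm p x \<le> real CARD('n) powr (1 / r) * e" .
  qed simp
  then show ?thesis by (simp add: r_def)
qed

lemma beta_max_norm_le:
  "beta (lp_norm \<infinity> :: real ^ 'n \<Rightarrow> real) (2 ^ CARD('n)) \<le> 1 / 2"
proof -
  have "beta (lp_norm \<infinity> :: real ^ 'n \<Rightarrow> real) (2 ^ CARD('n)) \<le> 1 * 1 / 2"
  proof (rule beta_le_parallelepiped[where f = "\<lambda>i. axis i 1"])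
    show "axis (undefined :: 'n) (1::real) \<noteq> 0"
      by (simp add: axis_eq_0_iff)
    show "\<bar>axis i 1 \<bullet> x\<bar> \<le> 1 * lp_norm \<infinity> x" for i :: 'n and x :: "real ^ 'n"
      by (simp add: lp_norm_def inner_axis')
    show "lp_norm \<infinity> x \<le> 1 * e"
      if "\<And>i. \<bar>axis i 1 \<bullet> x\<bar> \<le> e" for x :: "real ^ 'n" and e
      using that by (simp add: lp_norm_def inner_axis')
  qed simp
  then show ?thesis by simp
qed

section \<open>Two inequalities between power sums\<close>

text \<open>
  Dividing \<open>u\<close> and \<open>v\<close> by their sums reduces the claim to the case of sums \<open>1\<close>, where it follows by
  summing the weighted inequality between the arithmetic and the geometric mean.  Because
  \<open>0 powr 0 = 0\<close>, the terms with a vanishing factor are zero even for the exponents \<open>0\<close> and \<open>1\<close>.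
\<close>

lemma Holder_sum:
  fixes u v :: "'a \<Rightarrow> real"
  assumes fin: "finite I" and nonneg: "0 \<le> \<alpha>" "0 \<le> \<beta>" and sum1: "\<alpha> + \<beta> = 1"
    and u: "\<And>i. i \<in> I \<Longrightarrow> 0 \<le> u i" and v: "\<And>i. i \<in> I \<Longrightarrow> 0 \<le> v i"
  shows "(\<Sum>i\<in>I. u i powr \<alpha> * v i powr \<beta>) \<le> (\<Sum>i\<in>I. u i) powr \<alpha> * (\<Sum>i\<in>I. v i) powr \<beta>"
proof (cases "(\<Sum>i\<in>I. u i) = 0 \<or> (\<Sum>i\<in>I. v i) = 0")
  case True
  then have "u i = 0 \<or> v i = 0" if "i \<in> I" for i
    using that u v fin by (auto simp: sum_nonneg_eq_0_iff)
  then have "(\<Sum>i\<in>I. u i powr \<alpha> * v i powr \<beta>) = 0"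
    by (intro sum.neutral) auto
  then show ?thesis by simp
next
  case False
  define U where "U = (\<Sum>i\<in>I. u i)"
  define V where "V = (\<Sum>i\<in>I. v i)"
  have pos: "0 < U" "0 < V"
    using False sum_nonneg[of I u] sum_nonneg[of I v] u v by (auto simp: U_def V_def less_le)
  have "u i powr \<alpha> * v i powr \<beta> \<le> (\<alpha> * (u i / U) + \<beta> * (v i / V)) * (U powr \<alpha> * V powr \<beta>)"
    if i: "i \<in> I" for i
  proof (cases "u i = 0 \<or> v i = 0")
    case True
    then have "u i powr \<alpha> * v i powr \<beta> = 0" by auto
    also have "\<dots> \<le> (\<alpha> * (u i / U) + \<beta> * (v i / V)) * (U powr \<alpha> * V powr \<beta>)"
      using u[OF i] v[OF i] pos nonneg by simp
    finally show ?thesis .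
  next
    case False
    then have uv: "0 < u i" "0 < v i"
      using u[OF i] v[OF i] by auto
    have "u i powr \<alpha> * v i powr \<beta>
        = ((u i / U) powr \<alpha> * (v i / V) powr \<beta>) * (U powr \<alpha> * V powr \<beta>)"
      using uv pos by (simp add: powr_divide)
    also have "\<dots> \<le> (\<alpha> * (u i / U) + \<beta> * (v i / V)) * (U powr \<alpha> * V powr \<beta>)"
      using uv pos nonneg sum1 by (intro mult_right_mono Youngs_inequality_0) auto
    finally show ?thesis .
  qed
  then have "(\<Sum>i\<in>I. u i powr \<alpha> * v i powr \<beta>)
      \<le> (\<Sum>i\<in>I. (\<alpha> * (u i / U) + \<beta> * (v i / V)) * (U powr \<alpha> * V powr \<beta>))"
    by (rule sum_mono)
  also have "\<dots> = (\<alpha> * (U / U) + \<beta> * (V / V)) * (U powr \<alpha> * V powr \<beta>)"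
    by (simp add: U_def V_def sum.distrib flip: sum_distrib_left sum_distrib_right sum_divide_distrib)
  also have "\<dots> = U powr \<alpha> * V powr \<beta>"
    using pos sum1 by simp
  finally show ?thesis by (simp add: U_def V_def)
qed

text \<open>
  The exponent \<open>r = (2 - r) * 1 + (r - 1) * 2\<close> is a convex combination of \<open>1\<close> and \<open>2\<close>, so
  Hoelder's inequality bounds the \<open>r\<close>-th power sum by the first and the second one.
\<close>

lemma sum_powr_interpolation:
  fixes a :: "'a \<Rightarrow> real"
  assumes "finite I" "1 \<le> r" "r \<le> 2" "\<And>i. i \<in> I \<Longrightarrow> 0 \<le> a i"
  shows "(\<Sum>i\<in>I. a i powr r) \<le> (\<Sum>i\<in>I. a i) powr (2 - r) * (\<Sum>i\<in>I. (a i)\<^sup>2) powr (r - 1)"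
proof -
  have "a i powr r = a i powr (2 - r) * (a i)\<^sup>2 powr (r - 1)" if "i \<in> I" for i
  proof (cases "a i = 0")
    case False
    then have "0 < a i" using assms(4)[OF that] by simp
    then have "a i powr (2 - r) * (a i)\<^sup>2 powr (r - 1) = a i powr (2 - r) * a i powr (2 * (r - 1))"
      by (simp add: powr_powr flip: powr_numeral)
    also have "\<dots> = a i powr ((2 - r) + 2 * (r - 1))"
      by (rule powr_add [symmetric])
    finally show ?thesis by simp
  qed simp
  then have "(\<Sum>i\<in>I. a i powr r) = (\<Sum>i\<in>I. a i powr (2 - r) * (a i)\<^sup>2 powr (r - 1))"
    by simp
  also have "\<dots> \<le> (\<Sum>i\<in>I. a i) powr (2 - r) * (\<Sum>i\<in>I. (a i)\<^sup>2) powr (r - 1)"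
    using assms by (intro Holder_sum) auto
  finally show ?thesis .
qed

text \<open>
  The first factor interpolates the dual norm of \<open>f\<close> between the maximum norm, which is at most \<open>1\<close>,
  and the Euclidean norm.  The exponent conjugate to \<open>r\<close> is at least \<open>2\<close>, so coordinates of
  absolute value at most \<open>1\<close> can be replaced by powers of their squares before Hoelder's inequality
  is applied; this also covers \<open>r = 1\<close>, where the conjugate exponent is infinite.
\<close>

lemma inner_le_interpolation:
  fixes f x :: "real ^ 'n"
  assumes r: "1 \<le> r" "r \<le> 2" and f: "\<And>i. \<bar>f $ i\<bar> \<le> 1"
  shows "\<bar>f \<bullet> x\<bar> \<le> (\<Sum>i\<in>UNIV. (f $ i)\<^sup>2) powr (1 - 1 / r) * (\<Sum>i\<in>UNIV. \<bar>x $ i\<bar> powr r) powr (1 / r)"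
proof -
  have "\<bar>f $ i\<bar> \<le> (f $ i)\<^sup>2 powr (1 - 1 / r)" for i
  proof (cases "f $ i = 0")
    case False
    have "\<bar>f $ i\<bar> = \<bar>f $ i\<bar> powr 1"
      by simp
    also have "\<dots> \<le> \<bar>f $ i\<bar> powr (2 * (1 - 1 / r))"
      using r f[of i] by (intro powr_mono') (auto simp: field_simps)
    also have "\<dots> = (\<bar>f $ i\<bar> powr 2) powr (1 - 1 / r)"
      by (simp only: powr_powr)
    also have "\<bar>f $ i\<bar> powr 2 = (f $ i)\<^sup>2"
      using False by simp
    finally show ?thesis .
  qed simp
  moreover have "(\<bar>x $ i\<bar> powr r) powr (1 / r) = \<bar>x $ i\<bar>" for i
    using r by (simp add: powr_powr)
  ultimately have "\<bar>f $ i * x $ i\<bar> \<le> (f $ i)\<^sup>2 powr (1 - 1 / r) * (\<bar>x $ i\<bar> powr r) powr (1 / r)" for i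
    by (simp add: abs_mult mult_right_mono)
  then have "\<bar>f \<bullet> x\<bar> \<le> (\<Sum>i\<in>UNIV. (f $ i)\<^sup>2 powr (1 - 1 / r) * (\<bar>x $ i\<bar> powr r) powr (1 / r))"
    unfolding inner_vec_def inner_real_def
    by (intro order_trans[OF sum_abs] sum_mono)
  also have "\<dots> \<le> (\<Sum>i\<in>UNIV. (f $ i)\<^sup>2) powr (1 - 1 / r) * (\<Sum>i\<in>UNIV. \<bar>x $ i\<bar> powr r) powr (1 / r)"
    using r by (intro Holder_sum) auto
  finally show ?thesis .
qed

section \<open>Small exponents: a tilted parallelepiped\<close>

text \<open>
  The entry \<open>-1/3\<close> balances the vertices of the parallelepiped in the \<open>\<ell>\<^sub>1\<close> norm.  The point at which
  the three functionals take the values \<open>(1, 1, 1)\<close> is \<open>(3/5, 3/5, 3/5)\<close>, and the values \<open>(-1, 1, 1)\<close>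
  are taken at \<open>(6/5, -3/10, -3/10)\<close>; up to sign and permutation these are all vertices,
  and both have \<open>\<ell>\<^sub>1\<close> norm \<open>9/5\<close>.
\<close>

definition tilted :: "3 \<Rightarrow> real ^ 3" where
  "tilted i = (\<chi> j. if j = i then - 1 / 3 else 1)"

lemma tilted_inner: "tilted i \<bullet> x = x $ 1 + x $ 2 + x $ 3 - 4 / 3 * x $ i"
  using exhaust_3[of i] by (auto simp: tilted_def inner_vec_def sum_3)

lemma sum_tilted_squared: "(\<Sum>j\<in>UNIV. (tilted i $ j)\<^sup>2) = 19 / 9"
  using exhaust_3[of i] by (auto simp: tilted_def sum_3 power2_eq_square)

lemma tilted_inverse:
  "x $ j = 9 / 20 * (tilted 1 \<bullet> x + tilted 2 \<bullet> x + tilted 3 \<bullet> x) - 3 / 4 * (tilted j \<bullet> x)"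
  by (simp add: tilted_inner field_simps)

text \<open>
  The next lemmas bound the \<open>\<ell>\<^sub>1\<close> norm and the squared Euclidean norm of a point of the
  parallelepiped, written by \<open>tilted_inverse\<close> in terms of the values \<open>a\<close>, \<open>b\<close>, \<open>c\<close> of the functionals.
  The \<open>\<ell>\<^sub>1\<close> norm is the largest of eight linear forms.
\<close>

lemma box_sum_abs_le:
  fixes e a b c :: real
  assumes "\<bar>a\<bar> \<le> e" "\<bar>b\<bar> \<le> e" "\<bar>c\<bar> \<le> e"
  defines "s \<equiv> 9 / 20 * (a + b + c)"
  shows "\<bar>s - 3 / 4 * a\<bar> + \<bar>s - 3 / 4 * b\<bar> + \<bar>s - 3 / 4 * c\<bar> \<le> 9 / 5 * e"
proof -
  have bounds: "- e \<le> a" "a \<le> e" "- e \<le> b" "b \<le> e" "- e \<le> c" "c \<le> e"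
    using assms(1-3) by (auto simp: abs_le_iff)
  have abs_sum: "\<bar>u\<bar> + \<bar>v\<bar> + \<bar>w\<bar> \<le> K"
    if "u + v + w \<le> K" "u + v - w \<le> K" "u - v + w \<le> K" "u - v - w \<le> K"
      "- u + v + w \<le> K" "- u + v - w \<le> K" "- u - v + w \<le> K" "- u - v - w \<le> K" for u v w K :: real
    using that by (simp add: abs_if)
  show ?thesis
    unfolding s_def by (rule abs_sum; use bounds in \<open>simp add: field_simps\<close>)
qed

text \<open>
  The left-hand side attains \<open>3 - 3/25 = 72/25\<close> at the vertices with one or two negative signs.  Moving
  off the vertices by a total of \<open>r\<close> lowers the sum of squares by at least \<open>r\<close>.  It can lower
  \<open>(a + b + c)\<^sup>2\<close>, which is at least \<open>1\<close> at each vertex because three signs never cancel, to no less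
  than \<open>1 - 2 * r\<close>, and \<open>3/25 * 2 * r \<le> r\<close>.
\<close>

lemma cube_sum_squares_le:
  fixes a b c :: real
  assumes "\<bar>a\<bar> \<le> 1" "\<bar>b\<bar> \<le> 1" "\<bar>c\<bar> \<le> 1"
  shows "a\<^sup>2 + b\<^sup>2 + c\<^sup>2 - 3 / 25 * (a + b + c)\<^sup>2 \<le> 72 / 25"
proof -
  define r where "r = 3 - \<bar>a\<bar> - \<bar>b\<bar> - \<bar>c\<bar>"
  have "x\<^sup>2 \<le> \<bar>x\<bar>" if "\<bar>x\<bar> \<le> 1" for x :: real
    using mult_left_le[OF that, of "\<bar>x\<bar>"] by (simp add: power2_eq_square)
  then have squares: "a\<^sup>2 + b\<^sup>2 + c\<^sup>2 \<le> 3 - r"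
    unfolding r_def using assms by (smt (verit))
  have r: "0 \<le> r"
    unfolding r_def using assms by linarith
  have "1 - r \<le> \<bar>a + b + c\<bar>"
    unfolding r_def using assms by linarith
  then have "1 - 2 * r \<le> (a + b + c)\<^sup>2"
  proof (cases "r \<le> 1")
    case True
    have "1 - 2 * r \<le> (1 - r)\<^sup>2"
      by (simp add: power2_diff)
    also have "\<dots> \<le> \<bar>a + b + c\<bar>\<^sup>2"
      using True \<open>1 - r \<le> \<bar>a + b + c\<bar>\<close> by (intro power_mono) auto
    finally show ?thesis by simp
  next
    case False
    then show ?thesis
      using zero_le_power2[of "a + b + c"] by linarith
  qed
  with squares r show ?thesis by linarith
qed

lemma box_sum_squares_le:
  fixes e a b c :: real
  assumes "0 < e" "\<bar>a\<bar> \<le> e" "\<bar>b\<bar> \<le> e" "\<bar>c\<bar> \<le> e"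
  defines "s \<equiv> 9 / 20 * (a + b + c)"
  shows "(s - 3 / 4 * a)\<^sup>2 + (s - 3 / 4 * b)\<^sup>2 + (s - 3 / 4 * c)\<^sup>2 \<le> 81 / 50 * e\<^sup>2"
proof -
  have "(s - 3 / 4 * a)\<^sup>2 + (s - 3 / 4 * b)\<^sup>2 + (s - 3 / 4 * c)\<^sup>2
      = 9 / 16 * (a\<^sup>2 + b\<^sup>2 + c\<^sup>2 - 3 / 25 * (a + b + c)\<^sup>2)"
    by (simp add: s_def power2_eq_square field_simps)
  also have "\<dots> = 9 / 16 * e\<^sup>2 *
      ((a / e)\<^sup>2 + (b / e)\<^sup>2 + (c / e)\<^sup>2 - 3 / 25 * (a / e + b / e + c / e)\<^sup>2)"
    using assms(1) by (simp add: field_simps power2_eq_square)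
  also have "\<dots> \<le> 9 / 16 * e\<^sup>2 * (72 / 25)"
    using assms(1-4) by (intro mult_left_mono cube_sum_squares_le) auto
  finally show ?thesis by simp
qed

text \<open>
  This is the constant \<open>K\<close> for exponent \<open>r\<close>: \<open>9/5\<close> for \<open>r = 1\<close> and \<open>sqrt (81/50)\<close> for \<open>r = 2\<close>,
  with the weights \<open>2 / r - 1\<close> and \<open>2 - 2 / r\<close>.
\<close>

lemma tilted_box_power_sum_le:
  assumes r: "1 \<le> r" "r \<le> 2" and e: "0 < e" and box: "\<And>i. \<bar>tilted i \<bullet> x\<bar> \<le> e"
  shows "(\<Sum>j\<in>UNIV. \<bar>x $ j\<bar> powr r) powr (1 / r)
           \<le> (9 / 5) powr (2 / r - 1) * (81 / 50) powr (1 - 1 / r) * e"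
proof -
  have "(\<Sum>j\<in>UNIV. \<bar>x $ j\<bar>) \<le> 9 / 5 * e"
    using box_sum_abs_le[OF box[of 1] box[of 2] box[of 3]]
    by (simp only: sum_3 tilted_inverse [symmetric])
  moreover have "(\<Sum>j\<in>UNIV. \<bar>x $ j\<bar>\<^sup>2) \<le> 81 / 50 * e\<^sup>2"
    using box_sum_squares_le[OF e box[of 1] box[of 2] box[of 3]]
    by (simp only: sum_3 power2_abs tilted_inverse [symmetric])
  ultimately have "(\<Sum>j\<in>UNIV. \<bar>x $ j\<bar>) powr (2 - r) * (\<Sum>j\<in>UNIV. \<bar>x $ j\<bar>\<^sup>2) powr (r - 1)
      \<le> (9 / 5 * e) powr (2 - r) * (81 / 50 * e\<^sup>2) powr (r - 1)"
    using r by (intro mult_mono powr_mono2) (auto intro: sum_nonneg)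
  with sum_powr_interpolation[of UNIV r "\<lambda>j. \<bar>x $ j\<bar>"] r
  have "(\<Sum>j\<in>UNIV. \<bar>x $ j\<bar> powr r) \<le> (9 / 5 * e) powr (2 - r) * (81 / 50 * e\<^sup>2) powr (r - 1)"
    by force
  then have "(\<Sum>j\<in>UNIV. \<bar>x $ j\<bar> powr r) powr (1 / r)
      \<le> ((9 / 5 * e) powr (2 - r) * (81 / 50 * e\<^sup>2) powr (r - 1)) powr (1 / r)"
    using r by (intro powr_mono2) (auto intro: sum_nonneg)
  also have "\<dots> = (9 / 5 * e) powr (2 / r - 1) * (81 / 50 * e\<^sup>2) powr (1 - 1 / r)"
    using r by (simp add: powr_mult powr_powr diff_divide_distrib)
  also have "\<dots> = (9 / 5) powr (2 / r - 1) * (81 / 50) powr (1 - 1 / r)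
      * (e powr (2 / r - 1) * (e powr 2) powr (1 - 1 / r))"
  proof -
    have "(9 / 5 * e) powr (2 / r - 1) = (9 / 5) powr (2 / r - 1) * e powr (2 / r - 1)"
      and "(81 / 50 * e\<^sup>2) powr (1 - 1 / r) = (81 / 50) powr (1 - 1 / r) * e\<^sup>2 powr (1 - 1 / r)"
      using e by (intro powr_mult; simp)+
    moreover have "e powr 2 = e\<^sup>2"
      using e by simp
    ultimately show ?thesis
      by (simp only: mult_ac)
  qed
  also have "e powr (2 / r - 1) * (e powr 2) powr (1 - 1 / r) = e powr ((2 / r - 1) + 2 * (1 - 1 / r))"
    by (simp only: powr_powr powr_add)
  also have "\<dots> = e"
    using e by (simp add: algebra_simps)
  finally show ?thesis .
qed

lemma interpolated_constant_le:
  assumes r: "1 \<le> r" "r \<le> (2::real)"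
  shows "(19 / 9) powr (1 - 1 / r) * ((9 / 5) powr (2 / r - 1) * (81 / 50) powr (1 - 1 / r)) / 2
           \<le> sqrt (18 * 19) / 20"
proof -
  \<comment> \<open>The left-hand side is half a weighted geometric mean of \<open>9/5\<close> and \<open>s\<close>.\<close>
  define s where "s = sqrt (18 * 19) / 10"
  have s2: "s powr 2 = 171 / 50" and s: "9 / 5 \<le> s"
    unfolding s_def by (simp_all add: power_divide real_le_rsqrt power2_eq_square)
  have "(19 / 9) powr (1 - 1 / r) * ((9 / 5) powr (2 / r - 1) * (81 / 50) powr (1 - 1 / r))
      = (9 / 5) powr (2 / r - 1) * ((19 / 9) * (81 / 50)) powr (1 - 1 / r)"
    by (subst powr_mult) auto
  also have "\<dots> = (9 / 5) powr (2 / r - 1) * (s powr 2) powr (1 - 1 / r)"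
    by (simp add: s2)
  also have "\<dots> \<le> s powr (2 / r - 1) * (s powr 2) powr (1 - 1 / r)"
    using r s by (intro mult_right_mono powr_mono2) (auto simp: field_simps)
  also have "\<dots> = s powr ((2 / r - 1) + 2 * (1 - 1 / r))"
    by (simp only: powr_powr powr_add)
  also have "\<dots> = s"
    using s by (simp add: algebra_simps)
  finally show ?thesis
    by (simp only: s_def)
qed

lemma beta_lp_norm_small_exponent_le:
  fixes p :: ereal
  assumes p: "1 \<le> p" "p < 2"
  shows "beta (lp_norm p :: real ^ 3 \<Rightarrow> real) 8 \<le> sqrt (18 * 19) / 20"
proof -
  define r where "r = real_of_ereal p"
  have r: "1 \<le> r" "r \<le> 2"
    unfolding r_def using p by (cases p; simp)+
  have lp: "lp_norm p x = (\<Sum>i\<in>UNIV. \<bar>x $ i\<bar> powr r) powr (1 / r)" for x :: "real ^ 3"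
    using p by (auto simp: lp_norm_def r_def)
  have "beta (lp_norm p :: real ^ 3 \<Rightarrow> real) (2 ^ CARD(3))
      \<le> (19 / 9) powr (1 - 1 / r) * ((9 / 5) powr (2 / r - 1) * (81 / 50) powr (1 - 1 / r)) / 2"
  proof (rule beta_le_parallelepiped[where f = tilted])
    show "tilted 1 \<noteq> 0"
      by (auto simp: tilted_def vec_eq_iff)
    show "\<bar>tilted i \<bullet> x\<bar> \<le> (19 / 9) powr (1 - 1 / r) * lp_norm p x" for i x
      using inner_le_interpolation[OF r, of "tilted i" x]
      by (simp add: lp sum_tilted_squared) (simp add: tilted_def)
    show "lp_norm p x \<le> (9 / 5) powr (2 / r - 1) * (81 / 50) powr (1 - 1 / r) * e"
      if "0 < e" "\<And>i. \<bar>tilted i \<bullet> x\<bar> \<le> e" for x e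
      unfolding lp using r that by (rule tilted_box_power_sum_le)
  qed simp
  also note interpolated_constant_le[OF r]
  finally show ?thesis
    by simp
qed

theorem theorem16:
  fixes p :: ereal
  assumes "1 \<le> p"
  shows "beta (lp_norm p :: real ^ 3 \<Rightarrow> real) 8 \<le>
    (if p < 2 then sqrt (18 * 19) / 20
     else if p = \<infinity> then 1 / 2
     else 3 powr (1 / real_of_ereal p) / 2)"
  using beta_lp_norm_small_exponent_le[OF assms] beta_max_norm_le[where 'n = 3]
    beta_lp_norm_le[OF assms, where 'n = 3]
  by simp

end
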